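(* Let $n,p$ be positive integers with $p\le n$. Let $X_1,\dots,X_{n+1}$ be i.i.d. random vectors with distribution $\mathcal{N}_p(\mu,\Sigma)$. Then the minimax risk for estimating $\log\det\Sigma$ satisfies $$\inf_{\delta}\ \sup_{\Sigma}\ \mathbb{E}\left(\delta-\log\det\Sigma\right)^2\ \ge\ 2\cdot\frac pn,$$ where the infimum is taken over all measurable estimators $\delta$ and the supremum is taken over all possible positive definite covariance matrices $\Sigma$.
   Context: $\mathcal{N}_p(\mu,\Sigma)$ denotes the $p$-dimensional Gaussian distribution with mean $\mu$ and $p\times p$ covariance matrix $\Sigma$. An estimator $\delta$ is a real-valued measurable function of the sample $(X_1,\dots,X_{n+1})$. The expectation $\mathbb{E}$ is taken under i.i.d. sampling of $X_1,\dots,X_{n+1}$ from $\mathcal{N}_p(\mu,\Sigma)$.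
   Formalization: The mean μ is treated as unknown, so the supremum is taken over all means μ as well as all positive definite Σ; with a supremum over Σ alone at a fixed (hence known) μ the bound fails for p = n = 1, where risk π²/6 < 2 is attained. *)

theory Defs
  imports "HOL-Probability.Probability"
begin

definition pos_def_matrix :: "real ^ 'p ^ 'p \<Rightarrow> bool" where
  "pos_def_matrix S \<longleftrightarrow> transpose S = S \<and> (\<forall>x. x \<noteq> 0 \<longrightarrow> 0 < x \<bullet> (S *v x))"

definition gaussian_density :: "real ^ 'p \<Rightarrow> real ^ 'p ^ 'p \<Rightarrow> real ^ 'p \<Rightarrow> real" where
  "gaussian_density \<mu> S x =
     exp (- ((x - \<mu>) \<bullet> (matrix_inv S *v (x - \<mu>))) / 2) / sqrt ((2 * pi) ^ CARD('p) * det S)"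

(* Only meaningful for positive definite S. *)
definition gaussian :: "real ^ 'p \<Rightarrow> real ^ 'p ^ 'p \<Rightarrow> (real ^ 'p) measure" where
  "gaussian \<mu> S = density lborel (\<lambda>x. ennreal (gaussian_density \<mu> S x))"

(* Joint law of the i.i.d. observations X 1, ..., X (n + 1). *)
definition gaussian_sample ::
  "nat \<Rightarrow> real ^ 'p \<Rightarrow> real ^ 'p ^ 'p \<Rightarrow> (nat \<Rightarrow> real ^ 'p) measure" where
  "gaussian_sample n \<mu> S = (\<Pi>\<^sub>M i\<in>{1..n+1}. gaussian \<mu> S)"

(* An estimator sees the sample only: it depends neither on S nor on the mean, which is
   an unknown parameter of the model. *)
definition estimators :: "nat \<Rightarrow> ((nat \<Rightarrow> real ^ 'p) \<Rightarrow> real) set" where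
  "estimators n = borel_measurable (\<Pi>\<^sub>M i\<in>{1..n+1}. (borel :: (real ^ 'p) measure))"

(* Mean squared error, with values in ennreal so that an estimator whose squared error is
   not integrable has infinite risk. *)
definition logdet_risk ::
  "nat \<Rightarrow> ((nat \<Rightarrow> real ^ 'p) \<Rightarrow> real) \<Rightarrow> real ^ 'p \<Rightarrow> real ^ 'p ^ 'p \<Rightarrow> ennreal" where
  "logdet_risk n \<delta> \<mu> S =
     (\<integral>\<^sup>+ X. ennreal ((\<delta> X - ln (det S))\<^sup>2) \<partial>(gaussian_sample n \<mu> S))"

end

theory Submission
  imports Defs "HOL-Real_Asymp.Real_Asymp"
begin

text \<open>
  Scalar covariances \<open>S = I / v\<close> with precision \<open>v \<ge> 1\<close> already force the bound.
  There the target is \<open>- p ln v\<close>, and the sample carries two pieces of information on \<open>v\<close>: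
  the scatter around the sample mean, with \<open>n p\<close> degrees of freedom, and the distance of the
  sample mean from \<open>\<mu>\<close>, with \<open>p\<close> more.  Together they would only give an
  information bound of \<open>2 p / (n + 1)\<close>, so the second piece has to be destroyed by a prior on \<open>\<mu>\<close>.

  Write \<open>N = n + 1\<close>.  Given \<open>v\<close>, let \<open>\<mu>\<close> have the centred normal law with covariance
  \<open>(1 - 1 / (v N)) I\<close>.  The sample mean then has marginal covariance \<open>I\<close> for every \<open>v\<close>, and
  the marginal density of the whole sample is \<open>w(x) v\<^sup>a exp (- v T(x))\<close> where
  \<open>a = n p / 2\<close>, \<open>T\<close> is half the scatter and \<open>w\<close> is free of \<open>v\<close>
  (\<open>nn_integral_mean_mixture\<close>).  A supremum over \<open>\<mu>\<close> is at least an average, so what remains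
  is to estimate \<open>- p ln v\<close> in this one-parameter family, whose Fisher information about
  \<open>ln v\<close> is \<open>a\<close>; the value aimed at is \<open>p\<^sup>2 / a = 2 p / n\<close> (\<open>log_scale_risk_bound\<close>).

  That last step is a Bayesian Chapman--Robbins inequality for the uniform prior on the grid
  \<open>ln v = 0, \<epsilon>, \<dots>, J \<epsilon>\<close>.  Neighbouring differences of the densities telescope along the
  grid, which eliminates the estimator pointwise in the sample and makes its bias irrelevant
  (\<open>telescoped_quadratic_bound\<close>).  The chi-square distances between neighbours follow from
  the normalisation \<open>\<integral> w v\<^sup>a exp (- v T) = 1\<close> alone, since the square of one density divided
  by another is again a multiple of a member of the family (\<open>likelihood_ratio_square\<close>); no
  moment of \<open>T\<close> is ever computed.  Letting \<open>J \<rightarrow> \<infinity>\<close> removes the two boundary terms of the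
  grid, and \<open>\<epsilon> \<rightarrow> 0\<close> gives the sharp constant.
\<close>

section \<open>Estimating a logarithmic scale parameter\<close>

text \<open>
  For each grid point, Young's inequality bounds the squared error below by the error times
  the increment \<open>D k\<close> of \<open>b k * m k\<close>.  As \<open>b\<close> vanishes at both ends, these increments sum to
  zero, so the estimate \<open>d\<close> drops out of the sum; summation by parts against the target
  \<open>- \<beta> k\<close> leaves the left-hand side.
\<close>

lemma telescoped_quadratic_bound:
  fixes m b :: "nat \<Rightarrow> real"
  assumes pos: "\<And>k. 0 < m k" and b0: "b 0 = 0" and bJ: "b (Suc J) = 0"
  shows "2 * c * \<beta> * (\<Sum>k\<le>J. b k * m k)
    \<le> (\<Sum>k\<le>J. (d + \<beta> * real k)\<^sup>2 * m k)
      + c\<^sup>2 * (\<Sum>k\<le>J. (b (Suc k) * m (Suc k) - b k * m k)\<^sup>2 / m k)"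
proof -
  define D where "D k = b (Suc k) * m (Suc k) - b k * m k" for k
  have young: "- 2 * c * ((d + \<beta> * real k) * D k) \<le> (d + \<beta> * real k)\<^sup>2 * m k + c\<^sup>2 * ((D k)\<^sup>2 / m k)" for k
  proof -
    have "0 \<le> ((d + \<beta> * real k) * m k + c * D k)\<^sup>2 / m k"
      using pos[of k] by simp
    also have "\<dots> = (d + \<beta> * real k)\<^sup>2 * m k + c\<^sup>2 * ((D k)\<^sup>2 / m k) + 2 * c * ((d + \<beta> * real k) * D k)"
      using pos[of k] by (simp add: field_simps power2_eq_square)
    finally show ?thesis by linarith
  qed
  have tele: "(\<Sum>k\<le>n. (d + \<beta> * real k) * D k)
      = (d + \<beta> * real n) * (b (Suc n) * m (Suc n)) - d * (b 0 * m 0) + \<beta> * (b 0 * m 0) - \<beta> * (\<Sum>k\<le>n. b k * m k)" for n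
    by (induction n) (simp_all add: D_def algebra_simps)
  have "2 * c * \<beta> * (\<Sum>k\<le>J. b k * m k) = (\<Sum>k\<le>J. - 2 * c * ((d + \<beta> * real k) * D k))"
    unfolding sum_distrib_left[symmetric] tele using b0 bJ by simp
  also have "\<dots> \<le> (\<Sum>k\<le>J. (d + \<beta> * real k)\<^sup>2 * m k + c\<^sup>2 * ((D k)\<^sup>2 / m k))"
    by (rule sum_mono) (rule young)
  finally show ?thesis
    by (simp add: sum.distrib sum_distrib_left D_def)
qed

text \<open>
  The second moment of the likelihood ratio between log-precisions \<open>s + \<epsilon>\<close> and \<open>s\<close>, which
  does not depend on \<open>s\<close>; one less is their chi-square distance.
\<close>

definition gamma_ratio :: "real \<Rightarrow> real \<Rightarrow> real" where
  "gamma_ratio a \<epsilon> = (exp (2 * \<epsilon>) / (2 * exp \<epsilon> - 1)) powr a"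

text \<open>
  The Fisher information about \<open>ln v\<close>, as the second-order behaviour of the chi-square
  distance.
\<close>

lemma gamma_ratio_asymp:
  "((\<lambda>\<epsilon>. (gamma_ratio a \<epsilon> - 1) / \<epsilon>\<^sup>2) \<longlongrightarrow> a) (at_right 0)"
  unfolding gamma_ratio_def by real_asymp

text \<open>
  Exponents add, so the family is closed under this operation up to a constant factor.  The
  precision \<open>2 * t - s\<close> exceeds \<open>t\<close> when \<open>s < t\<close>, so going up the grid never leaves the
  range of precisions on which the family is normalised.
\<close>

lemma likelihood_ratio_square:
  fixes s t a T :: real
  assumes "0 < s" "s < 2 * t"
  shows "(t powr a * exp (- t * T))\<^sup>2 / (s powr a * exp (- s * T))
    = (t\<^sup>2 / (s * (2 * t - s))) powr a * ((2 * t - s) powr a * exp (- (2 * t - s) * T))"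
proof -
  have "exp (- t * T) * exp (- t * T) = exp (- s * T) * exp (- (2 * t - s) * T)"
    unfolding exp_add[symmetric] by (simp add: algebra_simps)
  moreover have "(s * (2 * t - s)) powr a = s powr a * (2 * t - s) powr a"
    using assms by (simp add: powr_mult)
  ultimately show ?thesis using assms
    by (simp add: powr_divide powr_mult power2_eq_square divide_simps)
qed

text \<open>
  The bound for a grid with \<open>J\<close> interior weights.  On the right, \<open>J\<close> chi-square distances
  appear, plus one unit from each end of the grid, where the weight jumps between 0 and 1.
\<close>

lemma prior_chain_bound:
  fixes \<nu> :: "'x measure" and T \<delta> :: "'x \<Rightarrow> real" and a p r \<epsilon> c :: real and J :: nat
  assumes [measurable]: "T \<in> borel_measurable \<nu>" "\<delta> \<in> borel_measurable \<nu>"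
    and norm1: "\<And>v. 1 \<le> v \<Longrightarrow> (\<integral>\<^sup>+x. ennreal (v powr a * exp (- v * T x)) \<partial>\<nu>) = 1"
    and risk: "\<And>v. 1 \<le> v \<Longrightarrow>
      (\<integral>\<^sup>+x. ennreal ((\<delta> x + p * ln v)\<^sup>2 * (v powr a * exp (- v * T x))) \<partial>\<nu>) \<le> ennreal r"
    and "0 \<le> r" "0 < \<epsilon>" "1 \<le> J"
  shows "2 * c * (p * \<epsilon>) * real J \<le> real (J + 1) * r + c\<^sup>2 * (real J * (gamma_ratio a \<epsilon> - 1) + 2)"
proof -
  define m where "m v x = v powr a * exp (- v * T x)" for v x
  \<comment> \<open>The grid of precisions, equally spaced on the logarithmic scale.\<close>
  define u where "u k = exp (\<epsilon> * real k)" for k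
  define \<gamma> where "\<gamma> = gamma_ratio a \<epsilon>"
  define b :: "nat \<Rightarrow> real" where "b k = of_bool (1 \<le> k \<and> k \<le> J)" for k
  \<comment> \<open>The member of the family that the squared likelihood ratio of neighbours is a multiple of.\<close>
  define w where "w k = 2 * u (Suc k) - u k" for k
  have u1: "1 \<le> u k" and upos: "0 < u k" for k
    using \<open>0 < \<epsilon>\<close> by (simp_all add: u_def)
  have uSuc: "u (Suc k) = exp \<epsilon> * u k" for k
    by (simp add: u_def exp_add[symmetric] algebra_simps)
  have ge: "u k \<le> u (Suc k)" for k
    using \<open>0 < \<epsilon>\<close> by (simp add: u_def)
  have w1: "1 \<le> w k" for k using ge[of k] u1[of k] by (simp add: w_def)
  have m_int: "integrable \<nu> (m v)" and m_one: "(\<integral>x. m v x \<partial>\<nu>) = 1" if "1 \<le> v" for v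
  proof -
    have *: "(\<integral>\<^sup>+x. ennreal (m v x) \<partial>\<nu>) = ennreal 1" using norm1[OF that] by (simp add: m_def)
    have "has_bochner_integral \<nu> (m v) 1"
      by (rule has_bochner_integral_nn_integral[OF _ _ _ *]) (simp_all add: m_def)
    then show "integrable \<nu> (m v)" "(\<integral>x. m v x \<partial>\<nu>) = 1"
      by (simp_all add: has_bochner_integral_iff)
  qed
  have r_int: "integrable \<nu> (\<lambda>x. (\<delta> x + p * ln v)\<^sup>2 * m v x)"
    and r_le: "(\<integral>x. (\<delta> x + p * ln v)\<^sup>2 * m v x \<partial>\<nu>) \<le> r" if "1 \<le> v" for v
  proof -
    have *: "(\<integral>\<^sup>+x. ennreal ((\<delta> x + p * ln v)\<^sup>2 * m v x) \<partial>\<nu>) \<le> ennreal r"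
      using risk[OF that] by (simp add: m_def)
    show "integrable \<nu> (\<lambda>x. (\<delta> x + p * ln v)\<^sup>2 * m v x)"
      using * by (intro integrableI_nonneg)
        (auto simp: m_def top_unique intro: le_less_trans ennreal_less_top)
    have "(\<integral>x. (\<delta> x + p * ln v)\<^sup>2 * m v x \<partial>\<nu>)
        = enn2real (\<integral>\<^sup>+x. ennreal ((\<delta> x + p * ln v)\<^sup>2 * m v x) \<partial>\<nu>)"
      by (rule integral_eq_nn_integral) (simp_all add: m_def)
    also have "\<dots> \<le> r" using enn2real_mono[OF *] \<open>0 \<le> r\<close> by simp
    finally show "(\<integral>x. (\<delta> x + p * ln v)\<^sup>2 * m v x \<partial>\<nu>) \<le> r" .
  qed
  have ratio: "(m (u (Suc k)) x)\<^sup>2 / m (u k) x = \<gamma> * m (w k) x" for k x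
  proof -
    have "(u (Suc k))\<^sup>2 / (u k * w k) = exp (2 * \<epsilon>) / (2 * exp \<epsilon> - 1)"
    proof -
      have "(u (Suc k))\<^sup>2 = exp (2 * \<epsilon>) * (u k)\<^sup>2"
        by (simp add: uSuc power_mult_distrib exp_double)
      moreover have "u k * w k = (2 * exp \<epsilon> - 1) * (u k)\<^sup>2"
        by (simp add: w_def uSuc algebra_simps power2_eq_square)
      ultimately show ?thesis using upos[of k] by simp
    qed
    then show ?thesis
      using likelihood_ratio_square[of "u k" "u (Suc k)" a "T x"] upos[of k] ge[of k]
      by (simp add: m_def w_def \<gamma>_def gamma_ratio_def)
  qed
  \<comment> \<open>The weights are idempotent, which keeps the expansion of the squared increment linear in them.\<close>
  have bb: "b k * b k = b k" for k by (simp add: b_def)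
  have mpos: "0 < m (u k) x" for k x using upos[of k] by (simp add: m_def)
  define q where "q k x = b (Suc k) * \<gamma> * m (w k) x - 2 * (b (Suc k) * b k) * m (u (Suc k)) x
      + b k * m (u k) x" for k x
  have q: "(b (Suc k) * m (u (Suc k)) x - b k * m (u k) x)\<^sup>2 / m (u k) x = q k x" for k x
  proof -
    have "(b (Suc k) * m (u (Suc k)) x - b k * m (u k) x)\<^sup>2 / m (u k) x
      = (b (Suc k) * b (Suc k)) * ((m (u (Suc k)) x)\<^sup>2 / m (u k) x)
        - 2 * (b (Suc k) * b k) * m (u (Suc k)) x + (b k * b k) * m (u k) x"
      using mpos[of k x] by (simp add: field_simps power2_eq_square)
    then show ?thesis by (simp only: bb ratio q_def mult.assoc)
  qed
  have q_int: "integrable \<nu> (q k)" for k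
    unfolding q_def using m_int u1 w1 by auto
  have q_val: "(\<integral>x. q k x \<partial>\<nu>) = b (Suc k) * \<gamma> - 2 * (b (Suc k) * b k) + b k" for k
    unfolding q_def using m_int u1 w1 by (simp add: m_one)
  have sum_q: "(\<Sum>k\<le>J. \<integral>x. q k x \<partial>\<nu>) = real J * (\<gamma> - 1) + 2"
  proof -
    have "{..J} = insert 0 (insert J {1..<J})" using \<open>1 \<le> J\<close> by auto
    moreover have "(\<Sum>k\<in>{1..<J}. \<integral>x. q k x \<partial>\<nu>) = (\<Sum>k\<in>{1..<J}. \<gamma> - 1)"
      by (rule sum.cong) (auto simp: q_val b_def)
    ultimately show ?thesis using \<open>1 \<le> J\<close>
      by (simp add: q_val b_def of_nat_diff algebra_simps)
  qed
  have sum_b: "(\<Sum>k\<le>J. b k) = real J"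
  proof -
    have "(\<Sum>k\<le>J. b k) = (\<Sum>k\<in>{1..J}. 1)"
      by (rule sum.mono_neutral_cong_right) (auto simp: b_def)
    then show ?thesis by simp
  qed
  have ln_u: "p * ln (u k) = p * \<epsilon> * real k" for k by (simp add: u_def)
  have int_r: "integrable \<nu> (\<lambda>x. (\<delta> x + p * \<epsilon> * real k)\<^sup>2 * m (u k) x)"
    and le_r: "(\<integral>x. (\<delta> x + p * \<epsilon> * real k)\<^sup>2 * m (u k) x \<partial>\<nu>) \<le> r" for k
    using r_int[OF u1[of k]] r_le[OF u1[of k]] by (simp_all add: ln_u)
  have "2 * c * (p * \<epsilon>) * real J = (\<integral>x. 2 * c * (p * \<epsilon>) * (\<Sum>k\<le>J. b k * m (u k) x) \<partial>\<nu>)"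
    using m_int u1 by (simp add: m_one sum_b)
  also have "\<dots> \<le> (\<integral>x. (\<Sum>k\<le>J. (\<delta> x + p * \<epsilon> * real k)\<^sup>2 * m (u k) x) + c\<^sup>2 * (\<Sum>k\<le>J. q k x) \<partial>\<nu>)"
  proof (rule integral_mono)
    fix x
    show "2 * c * (p * \<epsilon>) * (\<Sum>k\<le>J. b k * m (u k) x)
      \<le> (\<Sum>k\<le>J. (\<delta> x + p * \<epsilon> * real k)\<^sup>2 * m (u k) x) + c\<^sup>2 * (\<Sum>k\<le>J. q k x)"
      using telescoped_quadratic_bound[of "\<lambda>k. m (u k) x" b J c "p * \<epsilon>" "\<delta> x"] mpos
      by (simp add: b_def[of 0] b_def[of "Suc J"] q)
  qed (use m_int u1 int_r q_int in auto)
  also have "\<dots> = (\<Sum>k\<le>J. \<integral>x. (\<delta> x + p * \<epsilon> * real k)\<^sup>2 * m (u k) x \<partial>\<nu>) + c\<^sup>2 * (\<Sum>k\<le>J. \<integral>x. q k x \<partial>\<nu>)"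
    using int_r q_int by simp
  also have "\<dots> \<le> real (J + 1) * r + c\<^sup>2 * (real J * (\<gamma> - 1) + 2)"
    unfolding sum_q using sum_bounded_above[of "{..J}" "\<lambda>k. \<integral>x. (\<delta> x + p * \<epsilon> * real k)\<^sup>2 * m (u k) x \<partial>\<nu>" r] le_r
    by simp
  finally show ?thesis by (simp add: \<gamma>_def)
qed

text \<open>
  A van Trees inequality without its prior term: along the half-line \<open>ln v \<ge> 0\<close> the prior can be
  spread out indefinitely, and its own information vanishes in the limit \<open>J \<rightarrow> \<infinity>\<close>.
\<close>

lemma log_scale_risk_bound:
  fixes \<nu> :: "'x measure" and T \<delta> :: "'x \<Rightarrow> real" and a p r :: real
  assumes "T \<in> borel_measurable \<nu>" "\<delta> \<in> borel_measurable \<nu>"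
    and "\<And>v. 1 \<le> v \<Longrightarrow> (\<integral>\<^sup>+x. ennreal (v powr a * exp (- v * T x)) \<partial>\<nu>) = 1"
    and "\<And>v. 1 \<le> v \<Longrightarrow>
      (\<integral>\<^sup>+x. ennreal ((\<delta> x + p * ln v)\<^sup>2 * (v powr a * exp (- v * T x))) \<partial>\<nu>) \<le> ennreal r"
    and "0 \<le> r" "0 < a"
  shows "p\<^sup>2 / a \<le> r"
proof -
  have step: "2 * C * p \<le> r + C\<^sup>2 * ((gamma_ratio a \<epsilon> - 1) / \<epsilon>\<^sup>2)" if "0 < \<epsilon>" for C \<epsilon>
  proof -
    define \<kappa> where "\<kappa> = gamma_ratio a \<epsilon> - 1"
    \<comment> \<open>The multiplier must grow like \<open>1 / \<epsilon>\<close>, because neighbouring targets are only \<open>p * \<epsilon>\<close> apart.\<close>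
    have "2 * (C / \<epsilon>) * (p * \<epsilon>) \<le> r + r / real J + (C / \<epsilon>)\<^sup>2 * (\<kappa> + 2 / real J)" if "1 \<le> J" for J :: nat
    proof -
      have "2 * (C / \<epsilon>) * (p * \<epsilon>) * real J
          \<le> real (J + 1) * r + (C / \<epsilon>)\<^sup>2 * (real J * \<kappa> + 2)"
        unfolding \<kappa>_def
        by (rule prior_chain_bound[OF assms(1-5) \<open>0 < \<epsilon>\<close> that])
      also have "\<dots> = (r + r / real J + (C / \<epsilon>)\<^sup>2 * (\<kappa> + 2 / real J)) * real J"
        using that by (simp add: distrib_right mult.assoc)
      finally show ?thesis using that by simp
    qed
    then have "\<forall>\<^sub>F J :: nat in sequentially.
        2 * (C / \<epsilon>) * (p * \<epsilon>) \<le> r + r / real J + (C / \<epsilon>)\<^sup>2 * (\<kappa> + 2 / real J)"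
      by (rule eventually_mono[OF eventually_ge_at_top])
    moreover have "(\<lambda>J. r + r / real J + (C / \<epsilon>)\<^sup>2 * (\<kappa> + 2 / real J))
        \<longlonglongrightarrow> r + 0 + (C / \<epsilon>)\<^sup>2 * (\<kappa> + 0)"
      by (intro tendsto_intros lim_const_over_n)
    ultimately have "2 * (C / \<epsilon>) * (p * \<epsilon>) \<le> r + 0 + (C / \<epsilon>)\<^sup>2 * (\<kappa> + 0)"
      by (intro tendsto_lowerbound) auto
    then show ?thesis using that by (simp add: \<kappa>_def power_divide)
  qed
  have "2 * C * p \<le> r + C\<^sup>2 * a" for C
  proof (rule tendsto_lowerbound)
    show "((\<lambda>\<epsilon>. r + C\<^sup>2 * ((gamma_ratio a \<epsilon> - 1) / \<epsilon>\<^sup>2)) \<longlongrightarrow> r + C\<^sup>2 * a) (at_right 0)"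
      by (intro tendsto_intros gamma_ratio_asymp)
    show "\<forall>\<^sub>F \<epsilon> in at_right 0. 2 * C * p \<le> r + C\<^sup>2 * ((gamma_ratio a \<epsilon> - 1) / \<epsilon>\<^sup>2)"
      using step eventually_at_right_less[of 0] by (auto elim: eventually_mono)
  qed simp
  \<comment> \<open>The maximiser of \<open>2 * C * p - C\<^sup>2 * a\<close>.\<close>
  from this[of "p / a"] show ?thesis
    using \<open>0 < a\<close> by (simp add: field_simps power2_eq_square)
qed

section \<open>Isotropic normal distributions\<close>

lemma nn_integral_isotropic_gaussian:
  fixes c :: "'a::euclidean_space"
  assumes "0 < b"
  shows "(\<integral>\<^sup>+y. ennreal (exp (- b / 2 * (norm (y - c))\<^sup>2)) \<partial>lborel)
    = ennreal (sqrt (2 * pi / b) ^ DIM('a))"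
proof -
  have one: "(\<integral>\<^sup>+t. ennreal (exp (- b / 2 * (t - d)\<^sup>2)) \<partial>lborel) = ennreal (sqrt (2 * pi / b))" for d :: real
  proof -
    have *: "exp (- b / 2 * (t - d)\<^sup>2) = sqrt (2 * pi / b) * normal_density d (1 / sqrt b) t" for t
      using \<open>0 < b\<close> by (simp add: normal_density_def power_divide field_simps)
    have "(\<integral>\<^sup>+t. ennreal (exp (- b / 2 * (t - d)\<^sup>2)) \<partial>lborel)
       = (\<integral>\<^sup>+t. ennreal (sqrt (2 * pi / b)) * ennreal (normal_density d (1 / sqrt b) t) \<partial>lborel)"
      unfolding * using \<open>0 < b\<close> by (simp add: ennreal_mult normal_density_nonneg)
    also have "\<dots> = ennreal (sqrt (2 * pi / b)) * ennreal (\<integral>t. normal_density d (1 / sqrt b) t \<partial>lborel)"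
      using \<open>0 < b\<close> by (simp add: nn_integral_cmult nn_integral_eq_integral normal_density_nonneg)
    finally show ?thesis using \<open>0 < b\<close> by simp
  qed
  have "ennreal (exp (- b / 2 * (norm (y - c))\<^sup>2))
      = (\<Prod>e\<in>Basis. ennreal (exp (- b / 2 * (y \<bullet> e - c \<bullet> e)\<^sup>2)))" for y
  proof -
    have "(norm (y - c))\<^sup>2 = (\<Sum>e\<in>Basis. (y \<bullet> e - c \<bullet> e)\<^sup>2)"
      unfolding power2_norm_eq_inner by (subst euclidean_inner) (simp add: inner_diff_left power2_eq_square)
    then show ?thesis by (simp add: sum_distrib_left exp_sum prod_ennreal)
  qed
  then have "(\<integral>\<^sup>+y. ennreal (exp (- b / 2 * (norm (y - c))\<^sup>2)) \<partial>lborel)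
      = (\<integral>\<^sup>+y. (\<Prod>e\<in>Basis. ennreal (exp (- b / 2 * (y \<bullet> e - c \<bullet> e)\<^sup>2))) \<partial>lborel)"
    by simp
  also have "\<dots> = (\<Prod>e\<in>(Basis::'a set). \<integral>\<^sup>+t. ennreal (exp (- b / 2 * (t - c \<bullet> e)\<^sup>2)) \<partial>lborel)"
    by (rule nn_integral_lborel_prod) simp_all
  also have "\<dots> = ennreal (sqrt (2 * pi / b) ^ DIM('a))"
    using \<open>0 < b\<close> by (simp only: one) (simp add: ennreal_power)
  finally show ?thesis .
qed

lemma mat_times_vector: "(mat v :: real ^ 'p ^ 'p) *v y = v *\<^sub>R y"
proof -
  have "(\<Sum>j\<in>UNIV. (if i = j then v else 0) * y $ j) = v * y $ i" for i
    using sum.delta[of UNIV i "\<lambda>j. v * y $ j"] by (simp add: if_distribR if_distrib cong: if_cong)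
  then show ?thesis by (simp add: matrix_vector_mult_def mat_def vec_eq_iff)
qed

lemma
  fixes v :: real
  assumes "0 < v"
  shows matrix_inv_mat: "matrix_inv (mat v :: real ^ 'p ^ 'p) = mat (1 / v)"
    and det_mat: "det (mat v :: real ^ 'p ^ 'p) = v ^ CARD('p)"
    and pos_def_mat: "pos_def_matrix (mat v :: real ^ 'p ^ 'p)"
proof -
  have mm: "(mat x :: real ^ 'p ^ 'p) ** mat y = mat (x * y)" for x y
    unfolding matrix_eq matrix_vector_mul_assoc[symmetric] by (simp add: mat_times_vector)
  show "matrix_inv (mat v :: real ^ 'p ^ 'p) = mat (1 / v)"
  proof -
    have inv: "mat v ** (mat (1 / v) :: real ^ 'p ^ 'p) = mat 1" "mat (1 / v) ** (mat v :: real ^ 'p ^ 'p) = mat 1"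
      using assms by (simp_all add: mm)
    then have "matrix_inv (mat v) ** (mat v :: real ^ 'p ^ 'p) = mat 1"
      unfolding matrix_inv_def using someI_ex[of "\<lambda>A'. mat v ** A' = mat 1 \<and> A' ** (mat v :: real ^ 'p ^ 'p) = mat 1"] by blast
    then have "matrix_inv (mat v) ** ((mat v :: real ^ 'p ^ 'p) ** mat (1 / v)) = mat (1 / v)"
      by (simp only: matrix_mul_assoc matrix_mul_lid)
    then show ?thesis by (simp only: inv matrix_mul_rid)
  qed
  show "det (mat v :: real ^ 'p ^ 'p) = v ^ CARD('p)"
    by (subst det_diagonal) (simp_all add: mat_def)
  show "pos_def_matrix (mat v :: real ^ 'p ^ 'p)"
    using assms by (simp add: pos_def_matrix_def mat_times_vector)
qed

lemma gaussian_density_mat: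
  fixes \<mu> x :: "real ^ 'p"
  assumes "0 < v"
  shows "gaussian_density \<mu> (mat (1 / v)) x
    = sqrt (v / (2 * pi)) ^ CARD('p) * exp (- v / 2 * (norm (x - \<mu>))\<^sup>2)"
proof -
  show ?thesis
    using assms
    by (simp add: gaussian_density_def matrix_inv_mat det_mat mat_times_vector power2_norm_eq_inner
        real_sqrt_mult real_sqrt_divide real_sqrt_power power_divide power_mult_distrib scaleR_diff_right[symmetric] divide_simps)
qed

text \<open>
  Both sides agree on rectangles, by factorisation of the integral over a finite product, and
  rectangles determine a measure on the product.
\<close>

lemma PiM_density:
  fixes M :: "'i \<Rightarrow> 'a measure" and f :: "'i \<Rightarrow> 'a \<Rightarrow> ennreal"
  assumes "finite I" and M: "\<And>i. sigma_finite_measure (M i)"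
    and f[measurable]: "\<And>i. f i \<in> borel_measurable (M i)"
    and D: "\<And>i. sigma_finite_measure (density (M i) (f i))"
  shows "(\<Pi>\<^sub>M i\<in>I. density (M i) (f i)) = density (Pi\<^sub>M I M) (\<lambda>x. \<Prod>i\<in>I. f i (x i))"
proof -
  interpret M: product_sigma_finite M by (simp add: product_sigma_finite_def M)
  interpret D: product_sigma_finite "\<lambda>i. density (M i) (f i)" by (simp add: product_sigma_finite_def D)
  have sets_eq: "sets (\<Pi>\<^sub>M i\<in>I. density (M i) (f i)) = sets (Pi\<^sub>M I M)"
    by (rule sets_PiM_cong) simp_all
  have [measurable]: "(\<lambda>x. \<Prod>i\<in>I. f i (x i)) \<in> borel_measurable (Pi\<^sub>M I M)"
  proof (rule borel_measurable_prod_ennreal)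
    fix i assume [measurable]: "i \<in> I"
    show "(\<lambda>x. f i (x i)) \<in> borel_measurable (Pi\<^sub>M I M)" by measurable
  qed
  show ?thesis
  proof (rule D.PiM_eqI[symmetric, OF \<open>finite I\<close>])
    show "sets (density (Pi\<^sub>M I M) (\<lambda>x. \<Prod>i\<in>I. f i (x i))) = sets (\<Pi>\<^sub>M i\<in>I. density (M i) (f i))"
      using sets_eq by simp
    fix A assume A: "\<And>i. i \<in> I \<Longrightarrow> A i \<in> sets (density (M i) (f i))"
    then have A': "Pi\<^sub>E I A \<in> sets (Pi\<^sub>M I M)" using \<open>finite I\<close> by (intro sets_PiM_I_finite) auto
    have "emeasure (density (Pi\<^sub>M I M) (\<lambda>x. \<Prod>i\<in>I. f i (x i))) (Pi\<^sub>E I A)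
        = (\<integral>\<^sup>+x. (\<Prod>i\<in>I. f i (x i)) * indicator (Pi\<^sub>E I A) x \<partial>Pi\<^sub>M I M)"
      using A' \<open>finite I\<close> by (intro emeasure_density) simp_all
    also have "\<dots> = (\<integral>\<^sup>+x. (\<Prod>i\<in>I. f i (x i) * indicator (A i) (x i)) \<partial>Pi\<^sub>M I M)"
    proof (rule nn_integral_cong)
      fix x assume "x \<in> space (Pi\<^sub>M I M)"
      then have "indicator (Pi\<^sub>E I A) x = (\<Prod>i\<in>I. indicator (A i) (x i) :: ennreal)"
        using \<open>finite I\<close> by (auto simp: indicator_def space_PiM PiE_def Pi_def prod_zero_iff)
      then show "(\<Prod>i\<in>I. f i (x i)) * indicator (Pi\<^sub>E I A) x = (\<Prod>i\<in>I. f i (x i) * indicator (A i) (x i))"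
        by (simp add: prod.distrib)
    qed
    also have "\<dots> = (\<Prod>i\<in>I. \<integral>\<^sup>+x. f i x * indicator (A i) x \<partial>M i)"
      using A \<open>finite I\<close> by (intro M.product_nn_integral_prod) auto
    also have "\<dots> = (\<Prod>i\<in>I. emeasure (density (M i) (f i)) (A i))"
      using A by (intro prod.cong) (auto simp: emeasure_density)
    finally show "emeasure (density (Pi\<^sub>M I M) (\<lambda>x. \<Prod>i\<in>I. f i (x i))) (Pi\<^sub>E I A)
        = (\<Prod>i\<in>I. emeasure (density (M i) (f i)) (A i))" .
  qed
qed

lemma prob_space_isotropic_gaussian:
  fixes \<mu> :: "real ^ 'p"
  assumes "0 < v"
  shows "prob_space (gaussian \<mu> (mat (1 / v)))"
proof
  have "emeasure (gaussian \<mu> (mat (1 / v))) (space (gaussian \<mu> (mat (1 / v))))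
      = (\<integral>\<^sup>+x. ennreal (sqrt (v / (2 * pi)) ^ CARD('p)) * ennreal (exp (- v / 2 * (norm (x - \<mu>))\<^sup>2)) \<partial>lborel)"
    using assms by (simp add: gaussian_def emeasure_density gaussian_density_mat ennreal_mult)
  also have "\<dots> = ennreal (sqrt (v / (2 * pi)) ^ CARD('p)) * ennreal (sqrt (2 * pi / v) ^ CARD('p))"
    by (subst nn_integral_cmult) (simp_all only: nn_integral_isotropic_gaussian[OF assms], simp_all)
  also have "\<dots> = ennreal ((sqrt (v / (2 * pi)) * sqrt (2 * pi / v)) ^ CARD('p))"
    using assms by (simp add: ennreal_mult power_mult_distrib)
  also have "sqrt (v / (2 * pi)) * sqrt (2 * pi / v) = 1"
    using assms by (simp add: real_sqrt_mult[symmetric])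
  finally show "emeasure (gaussian \<mu> (mat (1 / v))) (space (gaussian \<mu> (mat (1 / v)))) = 1"
    by simp
qed

lemma gaussian_sample_density:
  fixes \<mu> :: "real ^ 'p"
  assumes "0 < v"
  shows "gaussian_sample n \<mu> (mat (1 / v)) = density (\<Pi>\<^sub>M i\<in>{1..n+1}. lborel)
    (\<lambda>x. ennreal (sqrt (v / (2 * pi)) ^ (CARD('p) * (n + 1))
      * exp (- v / 2 * (\<Sum>i\<in>{1..n+1}. (norm (x i - \<mu>))\<^sup>2))))"
proof -
  define f where "f x = sqrt (v / (2 * pi)) ^ CARD('p) * exp (- v / 2 * (norm (x - \<mu>))\<^sup>2)" for x
  have g: "gaussian \<mu> (mat (1 / v)) = density lborel (\<lambda>x. ennreal (f x))"
    unfolding gaussian_def f_def using assms by (simp add: gaussian_density_mat)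
  interpret prob_space "gaussian \<mu> (mat (1 / v))" by (rule prob_space_isotropic_gaussian) fact
  have "gaussian_sample n \<mu> (mat (1 / v))
      = density (\<Pi>\<^sub>M i\<in>{1..n+1}. lborel) (\<lambda>x. \<Prod>i\<in>{1..n+1}. ennreal (f (x i)))"
    unfolding gaussian_sample_def g
    by (rule PiM_density)
      (use sigma_finite_measure_axioms in \<open>simp_all add: g f_def sigma_finite_lborel\<close>)
  moreover have "(\<Prod>i\<in>{1..n+1}. ennreal (f (x i))) = ennreal (sqrt (v / (2 * pi)) ^ (CARD('p) * (n + 1))
      * exp (- v / 2 * (\<Sum>i\<in>{1..n+1}. (norm (x i - \<mu>))\<^sup>2)))" for x
  proof -
    have "(\<Prod>i\<in>{1..n+1}. ennreal (f (x i))) = ennreal (\<Prod>i\<in>{1..n+1}. f (x i))"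
      using assms by (intro prod_ennreal) (simp add: f_def)
    also have "(\<Prod>i\<in>{1..n+1}. f (x i)) = (sqrt (v / (2 * pi)) ^ CARD('p)) ^ (n + 1)
        * exp (\<Sum>i\<in>{1..n+1}. - v / 2 * (norm (x i - \<mu>))\<^sup>2)"
      unfolding f_def prod.distrib by (subst exp_sum) simp_all
    finally show ?thesis by (simp only: power_mult sum_distrib_left)
  qed
  ultimately show ?thesis by presburger
qed

section \<open>Averaging out the unknown mean\<close>

text \<open>
  Huygens' identity: the cross terms cancel because the deviations from the barycentre \<open>xb\<close>
  sum to zero.
\<close>

lemma sum_norm_diff_decomposition:
  fixes x :: "'i \<Rightarrow> 'a::real_inner"
  assumes "finite I" "I \<noteq> {}"
  defines "xb \<equiv> (1 / real (card I)) *\<^sub>R (\<Sum>i\<in>I. x i)"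
  shows "(\<Sum>i\<in>I. (norm (x i - \<mu>))\<^sup>2)
    = (\<Sum>i\<in>I. (norm (x i - xb))\<^sup>2) + real (card I) * (norm (\<mu> - xb))\<^sup>2"
proof -
  have N: "real (card I) \<noteq> 0" using assms by simp
  have "(\<Sum>i\<in>I. x i - xb) = 0"
    using N by (simp add: sum_subtractf xb_def sum_constant_scaleR)
  then have cross: "(\<Sum>i\<in>I. (x i - xb) \<bullet> (\<mu> - xb)) = 0"
    by (simp add: inner_sum_left[symmetric])
  have "(norm (x i - \<mu>))\<^sup>2 = (norm (x i - xb))\<^sup>2 + (norm (\<mu> - xb))\<^sup>2 - 2 * ((x i - xb) \<bullet> (\<mu> - xb))" for i
    unfolding power2_norm_eq_inner by (simp add: inner_diff_left inner_diff_right inner_commute)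
  then show ?thesis
    by (simp add: sum.distrib sum_subtractf sum_distrib_left[symmetric] cross)
qed

text \<open>
  The product of two normal densities for \<open>\<mu>\<close>, with precisions \<open>A\<close> (centred at \<open>y\<close>) and
  \<open>A / (A - 1)\<close> (centred at 0).  The second precision is chosen so that
  the two variances add up to 1: what is left after completing the square in \<open>\<mu>\<close>
  is \<open>(norm y)\<^sup>2\<close> with coefficient 1, whatever \<open>A\<close> is.
\<close>

lemma complete_square_gaussian_product:
  fixes \<mu> y :: "'a::real_inner"
  assumes "1 < A"
  shows "A * (norm (\<mu> - y))\<^sup>2 + A / (A - 1) * (norm \<mu>)\<^sup>2
    = A\<^sup>2 / (A - 1) * (norm (\<mu> - (1 - 1 / A) *\<^sub>R y))\<^sup>2 + (norm y)\<^sup>2"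
proof -
  have *: "(norm (\<mu> - c *\<^sub>R y))\<^sup>2 = (norm \<mu>)\<^sup>2 - 2 * c * (\<mu> \<bullet> y) + c\<^sup>2 * (norm y)\<^sup>2" for c
    unfolding power2_norm_eq_inner
    by (simp add: inner_diff_left inner_diff_right inner_commute power2_eq_square)
  have [simp]: "A \<noteq> 0" "A - 1 \<noteq> 0" using assms by auto
  have c1: "A + A / (A - 1) = A\<^sup>2 / (A - 1)"
    using assms by (simp add: divide_simps) (simp add: power2_eq_square algebra_simps)
  have c2: "A\<^sup>2 / (A - 1) * (1 - 1 / A) = A"
    using assms by (simp add: divide_simps) (simp add: power2_eq_square algebra_simps)
  have c3: "A\<^sup>2 / (A - 1) * (1 - 1 / A)\<^sup>2 + 1 = A"
    unfolding power2_eq_square[of "1 - 1 / A"] mult.assoc[symmetric] c2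
    by (simp add: right_diff_distrib)
  have "A * (norm (\<mu> - y))\<^sup>2 + A / (A - 1) * (norm \<mu>)\<^sup>2
      = (A + A / (A - 1)) * (norm \<mu>)\<^sup>2 - 2 * A * (\<mu> \<bullet> y) + A * (norm y)\<^sup>2"
    using *[of 1] by (simp add: distrib_right right_diff_distrib distrib_left)
  also have "\<dots> = A\<^sup>2 / (A - 1) * (norm \<mu>)\<^sup>2 - 2 * (A\<^sup>2 / (A - 1) * (1 - 1 / A)) * (\<mu> \<bullet> y)
      + (A\<^sup>2 / (A - 1) * (1 - 1 / A)\<^sup>2 + 1) * (norm y)\<^sup>2"
    by (simp only: c1 c2 c3)
  also have "\<dots> = A\<^sup>2 / (A - 1) * (norm (\<mu> - (1 - 1 / A) *\<^sub>R y))\<^sup>2 + (norm y)\<^sup>2"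
  proof -
    have "K * m - 2 * (K * c) * s + (K * c\<^sup>2 + 1) * z = K * (m - 2 * c * s + c\<^sup>2 * z) + z"
      for K c m s z :: real
      by (simp add: algebra_simps)
    then show ?thesis unfolding * .
  qed
  finally show ?thesis .
qed

definition sample_mean :: "nat \<Rightarrow> (nat \<Rightarrow> real ^ 'p) \<Rightarrow> real ^ 'p" where
  "sample_mean n x = (1 / real (n + 1)) *\<^sub>R (\<Sum>i\<in>{1..n+1}. x i)"

definition half_scatter :: "nat \<Rightarrow> (nat \<Rightarrow> real ^ 'p) \<Rightarrow> real" where
  "half_scatter n x = (\<Sum>i\<in>{1..n+1}. (norm (x i - sample_mean n x))\<^sup>2) / 2"

text \<open>
  The factor of the marginal density of the sample that does not involve the precision; it is
  the standard normal law of the sample mean up to constants.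
\<close>

definition mean_weight :: "nat \<Rightarrow> (nat \<Rightarrow> real ^ 'p) \<Rightarrow> real" where
  "mean_weight n x = sqrt (1 / (2 * pi)) ^ (CARD('p) * (n + 1)) * sqrt (1 / real (n + 1)) ^ CARD('p)
    * exp (- (norm (sample_mean n x))\<^sup>2 / 2)"

text \<open>
  The variance complements the variance \<open>1 / (v * (n + 1))\<close> of the sample mean given \<open>\<mu>\<close> to 1, so
  that the sample mean is marginally uninformative about \<open>v\<close>.  The prior must depend on \<open>v\<close> for
  this to hold exactly rather than only in the limit of a flat prior.
\<close>

definition mean_prior :: "nat \<Rightarrow> real \<Rightarrow> (real ^ 'p) measure" where
  "mean_prior n v = gaussian 0 (mat (1 - 1 / (v * real (n + 1))))"

lemma prob_space_mean_prior:
  assumes "0 < n" "1 \<le> v"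
  shows "prob_space (mean_prior n v :: (real ^ 'p) measure)"
proof -
  define A where "A = v * real (n + 1)"
  have "real (n + 1) \<le> A" using mult_right_mono[OF \<open>1 \<le> v\<close>, of "real (n + 1)"] by (simp add: A_def)
  then have "1 < A" using \<open>0 < n\<close> by linarith
  then have "0 < A / (A - 1)" and prec: "1 - 1 / A = 1 / (A / (A - 1))"
    by (simp_all add: field_simps)
  then show ?thesis
    unfolding mean_prior_def A_def[symmetric] prec by (intro prob_space_isotropic_gaussian)
qed

lemma measurable_sample_statistics [measurable]:
  shows "sample_mean n \<in> borel_measurable (\<Pi>\<^sub>M i\<in>{1..n+1}. lborel)"
    and "half_scatter n \<in> borel_measurable (\<Pi>\<^sub>M i\<in>{1..n+1}. lborel)"
    and "mean_weight n \<in> borel_measurable (\<Pi>\<^sub>M i\<in>{1..n+1}. lborel)"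
proof -
  have c[measurable]: "(\<lambda>x. x i) \<in> borel_measurable (\<Pi>\<^sub>M i\<in>{1..n+1}. lborel)" if "i \<in> {1..n+1}" for i
    using measurable_component_singleton[OF that, of "\<lambda>_. lborel"] by simp
  show m: "sample_mean n \<in> borel_measurable (\<Pi>\<^sub>M i\<in>{1..n+1}. lborel)"
    unfolding sample_mean_def
    by (intro borel_measurable_scaleR borel_measurable_const borel_measurable_sum c)
  note [measurable] = m
  show "mean_weight n \<in> borel_measurable (\<Pi>\<^sub>M i\<in>{1..n+1}. lborel)"
    unfolding mean_weight_def by measurable
  have "(\<lambda>x. (norm (x i - sample_mean n x))\<^sup>2) \<in> borel_measurable (\<Pi>\<^sub>M i\<in>{1..n+1}. lborel)"
    if [measurable]: "i \<in> {1..n+1}" for i by measurable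
  then show "half_scatter n \<in> borel_measurable (\<Pi>\<^sub>M i\<in>{1..n+1}. lborel)"
    unfolding half_scatter_def by (intro borel_measurable_divide borel_measurable_const borel_measurable_sum)
qed

text \<open>
  The density splits into a scatter part, constant in \<open>\<mu>\<close>, and a normal factor for \<open>\<mu>\<close> of
  precision \<open>A = v * (n + 1)\<close> around the sample mean.  Integrating the latter against the prior
  costs a factor \<open>sqrt (1 / A)\<close> per coordinate, which takes the power of \<open>v\<close> from
  \<open>p * (n + 1) / 2\<close> down to \<open>p * n / 2\<close>: the degrees of freedom paid for the unknown mean.
\<close>

lemma sample_density_mixture:
  fixes x :: "nat \<Rightarrow> real ^ 'p"
  assumes "0 < n" "1 \<le> v"
  shows "(\<integral>\<^sup>+\<mu>. ennreal (sqrt (v / (2 * pi)) ^ (CARD('p) * (n + 1))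
      * exp (- v / 2 * (\<Sum>i\<in>{1..n+1}. (norm (x i - \<mu>))\<^sup>2))) \<partial>mean_prior n v)
    = ennreal (mean_weight n x * (v powr (real (CARD('p) * n) / 2) * exp (- v * half_scatter n x)))"
proof -
  define A where "A = v * real (n + 1)"
  \<comment> \<open>The precision of the prior.\<close>
  define B where "B = A / (A - 1)"
  define K where "K = sqrt (v / (2 * pi)) ^ (CARD('p) * (n + 1))"
  define y where "y = sample_mean n x"
  have "real (n + 1) \<le> A" using mult_right_mono[OF \<open>1 \<le> v\<close>, of "real (n + 1)"] by (simp add: A_def)
  then have A: "1 < A" using \<open>0 < n\<close> by linarith
  then have B: "0 < B" and B': "1 - 1 / A = 1 / B" and AB: "0 < A\<^sup>2 / (A - 1)"
    by (simp_all add: B_def field_simps)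
  have v: "0 < v" and K: "0 \<le> K" using assms by (simp_all add: K_def)
  define Q where "Q = sqrt (B / (2 * pi)) ^ CARD('p)"
  have Q: "0 \<le> Q" using B by (simp add: Q_def)
  define E where "E = exp (- v * half_scatter n x) * exp (- (norm y)\<^sup>2 / 2)"
  have E: "0 \<le> E" by (simp add: E_def)
  have "(\<integral>\<^sup>+\<mu>. ennreal (K * exp (- v / 2 * (\<Sum>i\<in>{1..n+1}. (norm (x i - \<mu>))\<^sup>2))) \<partial>mean_prior n v)
      = (\<integral>\<^sup>+\<mu>. ennreal (Q * exp (- B / 2 * (norm \<mu>)\<^sup>2))
         * ennreal (K * exp (- v / 2 * (\<Sum>i\<in>{1..n+1}. (norm (x i - \<mu>))\<^sup>2))) \<partial>lborel)"
    unfolding mean_prior_def gaussian_def A_def[symmetric] B'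
    using gaussian_density_mat[OF B, where \<mu> = "0 :: real ^ 'p"] by (subst nn_integral_density) (simp_all add: Q_def)
  also have "\<dots> = (\<integral>\<^sup>+\<mu>. ennreal (Q * K * E)
      * ennreal (exp (- (A\<^sup>2 / (A - 1)) / 2 * (norm (\<mu> - (1 - 1 / A) *\<^sub>R y))\<^sup>2)) \<partial>lborel)"
  proof (rule nn_integral_cong)
    fix \<mu> :: "real ^ 'p"
    have swap: "Q * s * (K * t) = Q * K * E * u" if "s * t = E * u" for s t u
    proof -
      have "Q * s * (K * t) = Q * K * (s * t)" by (simp add: mult_ac)
      with that show ?thesis by (simp add: mult.assoc)
    qed
    have "(\<Sum>i\<in>{1..n+1}. (norm (x i - \<mu>))\<^sup>2) = 2 * half_scatter n x + real (n + 1) * (norm (\<mu> - y))\<^sup>2"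
      using sum_norm_diff_decomposition[of "{1..n+1}" x \<mu>]
      by (simp add: half_scatter_def y_def sample_mean_def)
    then have "- B / 2 * (norm \<mu>)\<^sup>2 + - v / 2 * (\<Sum>i\<in>{1..n+1}. (norm (x i - \<mu>))\<^sup>2)
       = - v * half_scatter n x - (A * (norm (\<mu> - y))\<^sup>2 + B * (norm \<mu>)\<^sup>2) / 2"
      by (simp add: A_def field_simps)
    also have "\<dots> = - v * half_scatter n x + - (norm y)\<^sup>2 / 2
        + - (A\<^sup>2 / (A - 1)) / 2 * (norm (\<mu> - (1 - 1 / A) *\<^sub>R y))\<^sup>2"
      unfolding B_def complete_square_gaussian_product[OF A] by (simp add: add_divide_distrib)
    finally have "exp (- B / 2 * (norm \<mu>)\<^sup>2) * exp (- v / 2 * (\<Sum>i\<in>{1..n+1}. (norm (x i - \<mu>))\<^sup>2))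
       = E * exp (- (A\<^sup>2 / (A - 1)) / 2 * (norm (\<mu> - (1 - 1 / A) *\<^sub>R y))\<^sup>2)"
      unfolding E_def exp_add[symmetric] by (rule arg_cong)
    then have "Q * exp (- B / 2 * (norm \<mu>)\<^sup>2) * (K * exp (- v / 2 * (\<Sum>i\<in>{1..n+1}. (norm (x i - \<mu>))\<^sup>2)))
       = Q * K * E * exp (- (A\<^sup>2 / (A - 1)) / 2 * (norm (\<mu> - (1 - 1 / A) *\<^sub>R y))\<^sup>2)"
      by (rule swap)
    then show "ennreal (Q * exp (- B / 2 * (norm \<mu>)\<^sup>2))
        * ennreal (K * exp (- v / 2 * (\<Sum>i\<in>{1..n+1}. (norm (x i - \<mu>))\<^sup>2)))
      = ennreal (Q * K * E)
        * ennreal (exp (- (A\<^sup>2 / (A - 1)) / 2 * (norm (\<mu> - (1 - 1 / A) *\<^sub>R y))\<^sup>2))"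
      using Q K E by (simp only: ennreal_mult[symmetric] mult_nonneg_nonneg exp_ge_zero)
  qed
  also have "\<dots> = ennreal (Q * K * E) * ennreal (sqrt (2 * pi / (A\<^sup>2 / (A - 1))) ^ CARD('p))"
    by (subst nn_integral_cmult) (simp_all only: nn_integral_isotropic_gaussian[OF AB], simp_all)
  also have "\<dots> = ennreal (K * (Q * sqrt (2 * pi / (A\<^sup>2 / (A - 1))) ^ CARD('p)) * E)"
    using Q K E A by (subst ennreal_mult[symmetric]) (simp_all add: mult_ac)
  also have "Q * sqrt (2 * pi / (A\<^sup>2 / (A - 1))) ^ CARD('p) = sqrt (1 / A) ^ CARD('p)"
  proof -
    have "B / (2 * pi) * (2 * pi / (A\<^sup>2 / (A - 1))) = 1 / A"
      using A by (simp add: B_def power2_eq_square)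
    then show ?thesis
      unfolding Q_def power_mult_distrib[symmetric] real_sqrt_mult[symmetric] by simp
  qed
  also have "K * sqrt (1 / A) ^ CARD('p)
     = sqrt (1 / (2 * pi)) ^ (CARD('p) * (n + 1)) * sqrt (1 / real (n + 1)) ^ CARD('p)
       * v powr (real (CARD('p) * n) / 2)"
  proof -
    have 1: "v powr (real (CARD('p) * n) / 2) = sqrt v ^ (CARD('p) * n)"
      using v by (simp add: powr_half_sqrt[symmetric] powr_powr powr_realpow[symmetric] mult_ac)
    have 2: "K = sqrt (1 / (2 * pi)) ^ (CARD('p) * (n + 1)) * (sqrt v ^ (CARD('p) * n) * sqrt v ^ CARD('p))"
      unfolding K_def by (simp add: real_sqrt_divide power_divide power_add mult_ac)
    have 3: "sqrt v ^ CARD('p) * sqrt (1 / A) ^ CARD('p) = sqrt (1 / real (n + 1)) ^ CARD('p)"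
      unfolding power_mult_distrib[symmetric] real_sqrt_mult[symmetric] using v by (simp add: A_def)
    show ?thesis unfolding 1 2 3[symmetric] by (simp only: mult.assoc mult.left_commute mult.commute)
  qed
  finally show ?thesis
    by (simp only: K_def mean_weight_def E_def y_def mult.assoc mult.left_commute mult.commute)
qed

text \<open>
  Averaging over the prior of the mean turns the normal sample into the one-parameter family
  of \<open>log_scale_risk_bound\<close>.  It is used twice: with \<open>g = 1\<close> for the normalisation of
  that family, and with \<open>g\<close> the squared error for the risk.
\<close>

lemma nn_integral_mean_mixture:
  fixes g :: "(nat \<Rightarrow> real ^ 'p) \<Rightarrow> ennreal"
  assumes "0 < n" "1 \<le> v" and g[measurable]: "g \<in> borel_measurable (\<Pi>\<^sub>M i\<in>{1..n+1}. lborel)"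
  shows "(\<integral>\<^sup>+\<mu>. (\<integral>\<^sup>+x. g x \<partial>gaussian_sample n \<mu> (mat (1 / v))) \<partial>mean_prior n v)
    = (\<integral>\<^sup>+x. g x * ennreal (v powr (real (CARD('p) * n) / 2) * exp (- v * half_scatter n x))
        \<partial>density (\<Pi>\<^sub>M i\<in>{1..n+1}. lborel) (\<lambda>x. ennreal (mean_weight n x)))"
proof -
  let ?P = "\<Pi>\<^sub>M i\<in>{1..n+1}. (lborel :: (real ^ 'p) measure)"
  let ?f = "\<lambda>\<mu> x. sqrt (v / (2 * pi)) ^ (CARD('p) * (n + 1))
      * exp (- v / 2 * (\<Sum>i\<in>{1..n+1}. (norm (x i - \<mu>))\<^sup>2))"
  have v: "0 < v" using assms by simp
  interpret P: product_sigma_finite "\<lambda>i :: nat. lborel :: (real ^ 'p) measure"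
    by (simp add: product_sigma_finite_def sigma_finite_lborel)
  interpret pair_sigma_finite "mean_prior n v :: (real ^ 'p) measure" ?P
    unfolding pair_sigma_finite_def
    using prob_space_imp_sigma_finite[OF prob_space_mean_prior[OF assms(1,2)]] P.sigma_finite[of "{1..n+1}"] by simp
  have sets_prior[measurable_cong]: "sets (mean_prior n v) = sets borel"
    by (simp add: mean_prior_def gaussian_def)
  have f_meas: "(\<lambda>z. ennreal (?f (fst z) (snd z))) \<in> borel_measurable (mean_prior n v \<Otimes>\<^sub>M ?P)"
  proof -
    have "(\<lambda>z. (norm (snd z i - fst z))\<^sup>2) \<in> borel_measurable (mean_prior n v \<Otimes>\<^sub>M ?P)"
      if i: "i \<in> {1..n+1}" for i
    proof -
      have [measurable]: "(\<lambda>z. snd z i) \<in> borel_measurable (mean_prior n v \<Otimes>\<^sub>M ?P)"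
        using measurable_compose[OF measurable_snd measurable_component_singleton[OF i, of "\<lambda>_. lborel"]] by simp
      show ?thesis by measurable
    qed
    then have [measurable]: "(\<lambda>z. \<Sum>i\<in>{1..n+1}. (norm (snd z i - fst z))\<^sup>2)
        \<in> borel_measurable (mean_prior n v \<Otimes>\<^sub>M ?P)"
      by (rule borel_measurable_sum)
    show ?thesis by measurable
  qed
  have f_meas2: "(\<lambda>x. ennreal (?f \<mu> x)) \<in> borel_measurable ?P" for \<mu>
    using measurable_compose[OF measurable_Pair1' f_meas, of \<mu>] by (simp add: mean_prior_def gaussian_def)
  have f_meas1: "(\<lambda>\<mu>. ennreal (?f \<mu> x)) \<in> borel_measurable (mean_prior n v)" if "x \<in> space ?P" for x
    using measurable_compose[OF measurable_Pair2'[OF that] f_meas] by simp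
  have joint: "(\<lambda>(\<mu>, x). ennreal (?f \<mu> x) * g x) \<in> borel_measurable (mean_prior n v \<Otimes>\<^sub>M ?P)"
    using f_meas unfolding split_beta by measurable
  have "(\<integral>\<^sup>+\<mu>. (\<integral>\<^sup>+x. g x \<partial>gaussian_sample n \<mu> (mat (1 / v))) \<partial>mean_prior n v)
      = (\<integral>\<^sup>+\<mu>. (\<integral>\<^sup>+x. ennreal (?f \<mu> x) * g x \<partial>?P) \<partial>mean_prior n v)"
    unfolding gaussian_sample_density[OF v]
    by (intro nn_integral_cong nn_integral_density f_meas2 g)
  also have "\<dots> = (\<integral>\<^sup>+x. (\<integral>\<^sup>+\<mu>. ennreal (?f \<mu> x) * g x \<partial>mean_prior n v) \<partial>?P)"
    using Fubini'[OF joint] by simp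
  also have "\<dots> = (\<integral>\<^sup>+x. (\<integral>\<^sup>+\<mu>. ennreal (?f \<mu> x) \<partial>mean_prior n v) * g x \<partial>?P)"
    by (intro nn_integral_cong nn_integral_multc f_meas1)
  also have "\<dots> = (\<integral>\<^sup>+x. ennreal (mean_weight n x) *
      (g x * ennreal (v powr (real (CARD('p) * n) / 2) * exp (- v * half_scatter n x))) \<partial>?P)"
    unfolding sample_density_mixture[OF assms(1,2)]
    by (intro nn_integral_cong) (simp add: mean_weight_def ennreal_mult mult_ac)
  also have "\<dots> = (\<integral>\<^sup>+x. g x * ennreal (v powr (real (CARD('p) * n) / 2) * exp (- v * half_scatter n x))
        \<partial>density ?P (\<lambda>x. ennreal (mean_weight n x)))"
    by (rule nn_integral_density[symmetric]) measurable
  finally show ?thesis .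
qed

section \<open>The minimax bound\<close>

theorem theorem3:
  fixes n p :: nat
  assumes "0 < n" and "0 < p" and "p = CARD('p::finite)" and "p \<le> n"
  shows "(INF \<delta> \<in> (estimators n :: ((nat \<Rightarrow> real ^ 'p) \<Rightarrow> real) set).
            SUP \<mu>. SUP S \<in> {S. pos_def_matrix S}. logdet_risk n \<delta> \<mu> S)
         \<ge> ennreal (2 * (real p / real n))"
proof (rule INF_greatest)
  fix \<delta> :: "(nat \<Rightarrow> real ^ 'p) \<Rightarrow> real"
  assume "\<delta> \<in> estimators n"
  moreover have "sets (\<Pi>\<^sub>M i\<in>{1..n+1}. (lborel :: (real ^ 'p) measure)) = sets (\<Pi>\<^sub>M i\<in>{1..n+1}. borel)"
    by (rule sets_PiM_cong) simp_all
  ultimately have [measurable]: "\<delta> \<in> borel_measurable (\<Pi>\<^sub>M i\<in>{1..n+1}. lborel)"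
    unfolding estimators_def using measurable_cong_sets by blast
  have loss: "(\<lambda>x. ennreal ((\<delta> x + c)\<^sup>2)) \<in> borel_measurable (\<Pi>\<^sub>M i\<in>{1..n+1}. lborel)" for c
    by measurable
  let ?\<nu> = "density (\<Pi>\<^sub>M i\<in>{1..n+1}. lborel) (\<lambda>x. ennreal (mean_weight n x)) :: (nat \<Rightarrow> real ^ 'p) measure"
  define a where "a = real (CARD('p) * n) / 2"
  define R where "R = (SUP \<mu>. SUP S \<in> {S. pos_def_matrix S}. logdet_risk n \<delta> \<mu> S)"
  show "ennreal (2 * (real p / real n)) \<le> R"
  proof (cases R)
    case (real r)
    have "(real CARD('p))\<^sup>2 / a \<le> r"
    proof (rule log_scale_risk_bound[where \<nu> = ?\<nu> and T = "half_scatter n" and \<delta> = \<delta>])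
      show "half_scatter n \<in> borel_measurable ?\<nu>" "\<delta> \<in> borel_measurable ?\<nu>"
        by measurable
      show "0 \<le> r" using real by simp
      show "0 < a" using \<open>0 < n\<close> by (simp add: a_def)
    next
      fix v :: real assume v: "1 \<le> v"
      interpret prior: prob_space "mean_prior n v :: (real ^ 'p) measure"
        by (rule prob_space_mean_prior) fact+
      have sample: "prob_space (gaussian_sample n \<mu> (mat (1 / v)))" for \<mu> :: "real ^ 'p"
        unfolding gaussian_sample_def
        using v by (intro prob_space_PiM prob_space_isotropic_gaussian) simp
      have "(\<integral>\<^sup>+x. 1 * ennreal (v powr a * exp (- v * half_scatter n x)) \<partial>?\<nu>)
          = (\<integral>\<^sup>+(\<mu> :: real ^ 'p). (\<integral>\<^sup>+x. 1 \<partial>gaussian_sample n \<mu> (mat (1 / v))) \<partial>mean_prior n v)"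
        unfolding a_def by (rule nn_integral_mean_mixture[OF \<open>0 < n\<close> v borel_measurable_const, symmetric])
      also have "\<dots> = 1"
        using sample by (simp add: prob_space.emeasure_space_1 prior.emeasure_space_1)
      finally show "(\<integral>\<^sup>+x. ennreal (v powr a * exp (- v * half_scatter n x)) \<partial>?\<nu>) = 1" by simp
      have risk: "(\<integral>\<^sup>+x. ennreal ((\<delta> x + real CARD('p) * ln v)\<^sup>2) \<partial>gaussian_sample n \<mu> (mat (1 / v))) \<le> R"
        for \<mu>
      proof -
        have "ln (det (mat (1 / v) :: real ^ 'p ^ 'p)) = - real CARD('p) * ln v"
          using v by (simp add: det_mat ln_div ln_realpow power_one_over ln_inverse)
        then have "(\<integral>\<^sup>+x. ennreal ((\<delta> x + real CARD('p) * ln v)\<^sup>2) \<partial>gaussian_sample n \<mu> (mat (1 / v)))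
          = logdet_risk n \<delta> \<mu> (mat (1 / v))"
          by (simp add: logdet_risk_def)
        also have "\<dots> \<le> R"
          unfolding R_def using v
          by (intro SUP_upper2[of \<mu>] SUP_upper2[of "mat (1 / v)"]) (simp_all add: pos_def_mat)
        finally show ?thesis .
      qed
      have "(\<integral>\<^sup>+x. ennreal ((\<delta> x + real CARD('p) * ln v)\<^sup>2 * (v powr a * exp (- v * half_scatter n x))) \<partial>?\<nu>)
        = (\<integral>\<^sup>+x. ennreal ((\<delta> x + real CARD('p) * ln v)\<^sup>2) * ennreal (v powr a * exp (- v * half_scatter n x)) \<partial>?\<nu>)"
        by (simp add: ennreal_mult)
      also have "\<dots> = (\<integral>\<^sup>+\<mu>. (\<integral>\<^sup>+x. ennreal ((\<delta> x + real CARD('p) * ln v)\<^sup>2)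
          \<partial>gaussian_sample n \<mu> (mat (1 / v))) \<partial>mean_prior n v)"
        unfolding a_def by (rule nn_integral_mean_mixture[OF \<open>0 < n\<close> v loss, symmetric])
      also have "\<dots> \<le> (\<integral>\<^sup>+(\<mu> :: real ^ 'p). R \<partial>mean_prior n v)"
        by (intro nn_integral_mono risk)
      also have "\<dots> = R" by (simp add: prior.emeasure_space_1)
      finally show "(\<integral>\<^sup>+x. ennreal ((\<delta> x + real CARD('p) * ln v)\<^sup>2
          * (v powr a * exp (- v * half_scatter n x))) \<partial>?\<nu>) \<le> ennreal r"
        using real by simp
    qed
    moreover have "(real CARD('p))\<^sup>2 / a = 2 * (real p / real n)"
      using assms by (simp add: a_def power2_eq_square)
    ultimately show ?thesis using real by (simp add: ennreal_leI)
  qed simp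
qed

end
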